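(* Let $X,Y$ be complete metric spaces and let $E,F$ be nontrivial Banach spaces. If there is a biseparating map from $U(X,E)$ onto $U_*(Y,F)$, then $X$ is Bourbaki bounded.
   Context: $U(X,E)$ is the space of uniformly continuous functions $X\to E$ and $U_*(Y,F)$ the space of bounded uniformly continuous functions $Y\to F$. For a function $f$ let $C(f)=\{x: f(x)\neq 0\}$, and write $f\perp_h g$ if $C(f-h)\cap C(g-h)=\emptyset$. A map $T$ (not assumed linear) between two function spaces is biseparating if it is a bijection and for all $f,g,h$ in its domain: $f\perp_h g\iff Tf\perp_{Th}Tg$. For $\varepsilon>0$ define $d_\varepsilon(a,b)=\inf\{\sum_{i=1}^n d(x_{i-1},x_i): n\in\mathbb{N}, x_0=a, x_n=b, d(x_{i-1},x_i)\le\varepsilon\text{ for all }i\}$ for $a,b\in X$, with $\inf\emptyset=\infty$. The relation $a\sim_\varepsilon b\iff d_\varepsilon(a,b)<\infty$ is an equivalence relation whose classes are called $\varepsilon$-sets; $d_\varepsilon$ is a finite-valued metric on each $\varepsilon$-set. $X$ is Bourbaki bounded if for any $\varepsilon>0$ there are only finitely many $\varepsilon$-sets, each of which is bounded in the $d_\varepsilon$ metric. *)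

theory Defs
  imports "HOL-Analysis.Analysis"
begin

definition unif_cont_funs :: "('a::metric_space \<Rightarrow> 'e::real_normed_vector) set"
  where "unif_cont_funs = {f. uniformly_continuous_on UNIV f}"

definition bdd_unif_cont_funs :: "('a::metric_space \<Rightarrow> 'e::real_normed_vector) set"
  where "bdd_unif_cont_funs = {f. uniformly_continuous_on UNIV f \<and> bounded (range f)}"

text \<open>The set \<open>C(f)\<close>; no closure is taken.\<close>
definition cozero :: "('a \<Rightarrow> 'e::zero) \<Rightarrow> 'a set"
  where "cozero f = {x. f x \<noteq> 0}"

text \<open>\<open>perp h f g\<close> is the relation written \<open>f \<perp>\<^sub>h g\<close>.\<close>
definition perp :: "('a \<Rightarrow> 'e::group_add) \<Rightarrow> ('a \<Rightarrow> 'e) \<Rightarrow> ('a \<Rightarrow> 'e) \<Rightarrow> bool"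
  where "perp h f g \<longleftrightarrow> cozero (\<lambda>x. f x - h x) \<inter> cozero (\<lambda>x. g x - h x) = {}"

definition biseparating ::
  "('a \<Rightarrow> 'e::group_add) set \<Rightarrow> ('b \<Rightarrow> 'f::group_add) set \<Rightarrow> (('a \<Rightarrow> 'e) \<Rightarrow> ('b \<Rightarrow> 'f)) \<Rightarrow> bool"
  where "biseparating A B T \<longleftrightarrow>
    bij_betw T A B \<and> (\<forall>f\<in>A. \<forall>g\<in>A. \<forall>h\<in>A. perp h f g \<longleftrightarrow> perp (T h) (T f) (T g))"

text \<open>Values lie in \<^typ>\<open>ereal\<close> so that the infimum over the empty set of chains is \<open>\<infinity>\<close>.\<close>
definition chain_dist :: "'a::metric_space set \<Rightarrow> real \<Rightarrow> 'a \<Rightarrow> 'a \<Rightarrow> ereal"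
  where "chain_dist X \<epsilon> a b =
    Inf {ereal (\<Sum>i=1..n. dist (x (i - 1)) (x i)) | (n::nat) (x::nat \<Rightarrow> 'a).
           (\<forall>i\<le>n. x i \<in> X) \<and> x 0 = a \<and> x n = b \<and> (\<forall>i\<in>{1..n}. dist (x (i - 1)) (x i) \<le> \<epsilon>)}"

definition eps_sets :: "'a::metric_space set \<Rightarrow> real \<Rightarrow> 'a set set"
  where "eps_sets X \<epsilon> = X // {(a, b). a \<in> X \<and> b \<in> X \<and> chain_dist X \<epsilon> a b < \<infinity>}"

definition bourbaki_bounded :: "'a::metric_space set \<Rightarrow> bool"
  where "bourbaki_bounded X \<longleftrightarrow>
    (\<forall>\<epsilon>>0. finite (eps_sets X \<epsilon>) \<and>
       (\<forall>S\<in>eps_sets X \<epsilon>. \<exists>M::real. \<forall>a\<in>S. \<forall>b\<in>S. chain_dist X \<epsilon> a b \<le> ereal M))"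

end

theory Submission
  imports Defs
begin

text \<open>
  Fix \<open>v \<noteq> 0\<close> in the target and let \<open>f\<^sub>s\<close> be the \<open>T\<close>-preimage of the constant function \<open>s v\<close>
  (called \<open>level s\<close> below). Biseparating maps act locally: if \<open>f\<close> agrees with \<open>f\<^sub>n\<close> on a small
  ball, then \<open>T f\<close> takes the value \<open>n v\<close> somewhere, because a perturbation of \<open>f\<^sub>n\<close> supported in
  that ball has to change the value of \<open>T\<close> at some point, and there the separation condition with
  base \<open>f\<^sub>n\<close> forces \<open>T f = T f\<^sub>n\<close>. Hence no uniformly continuous \<open>f\<close> can agree with every \<open>f\<^sub>n\<close> near
  some point \<open>x\<^sub>n\<close>, as \<open>T f\<close> would be unbounded. If the \<open>x\<^sub>n\<close> are uniformly separated, it is even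
  impossible that \<open>f (x\<^sub>n) = f\<^sub>n (x\<^sub>n)\<close> for all \<open>n\<close>: replacing \<open>f\<close> by \<open>f\<^sub>n\<close> in a tiny neighbourhood
  of \<open>x\<^sub>n\<close> does not destroy uniform continuity (lemma \<open>no_interpolation\<close>).

  A space that is not Bourbaki bounded has too many uniformly continuous functions for this. If for
  some \<open>\<epsilon>\<close> there are infinitely many \<open>\<epsilon>\<close>-sets, a function constant on each of them may take the
  values \<open>f\<^sub>n (x\<^sub>n)\<close> on different \<open>\<epsilon>\<close>-sets. Otherwise some \<open>\<epsilon>\<close>-set is unbounded for the chain
  metric, and the chain distance from a fixed point is an unbounded uniformly continuous function
  \<open>D\<close>. Take a sequence \<open>x\<close> with \<open>D (x\<^sub>n) \<rightarrow> \<infinity>\<close>. A function of the form \<open>f\<^sub>0 + G \<circ> D\<close> with \<open>G\<close>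
  Lipschitz takes the values \<open>f\<^sub>m\<close> along a sparse subsequence, provided that for each fixed \<open>m\<close> the
  differences \<open>f\<^sub>m (x\<^sub>n) - f\<^sub>0 (x\<^sub>n)\<close> stay bounded as \<open>n \<rightarrow> \<infinity>\<close>.

  That boundedness is the heart of the proof. It follows from connectedness of the real line once
  each \<open>s\<close> has a neighbourhood of parameters \<open>t\<close> with \<open>f\<^sub>t (x\<^sub>n) - f\<^sub>s (x\<^sub>n)\<close> bounded for large
  \<open>n\<close>. If this failed, there would be \<open>t\<^sub>n \<rightarrow> s\<close> violating it along a subsequence; the function that
  equals \<open>s v\<close> except for narrow bumps of height \<open>t\<^sub>n - s\<close> at places corresponding to \<open>x\<^sub>n\<close> is
  still uniformly continuous, so its preimage \<open>f\<close> is too. But \<open>f\<close> agrees with \<open>f\<^sub>s\<close> away from the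
  \<open>x\<^sub>n\<close> and with \<open>f\<^bsub>t\<^sub>n\<^esub>\<close> at a point next to \<open>x\<^sub>n\<close>. As there are only finitely many \<open>\<epsilon>\<close>-sets
  for every \<open>\<epsilon>\<close>, the points \<open>x\<^sub>n\<close> have other points arbitrarily near to them when \<open>n\<close> is large,
  and uniform continuity of \<open>f\<close> and \<open>f\<^sub>s\<close> makes \<open>f\<^bsub>t\<^sub>n\<^esub> (x\<^sub>n) - f\<^sub>s (x\<^sub>n)\<close> small
  (lemma \<open>levels_close_somewhere\<close>).
\<close>

section \<open>Uniformly continuous functions: cutting off and gluing\<close>

lemma unif_cont_funs_iff:
  "f \<in> unif_cont_funs \<longleftrightarrow> (\<forall>e>0. \<exists>d>0. \<forall>x y. dist x y < d \<longrightarrow> dist (f x) (f y) < e)"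
  unfolding unif_cont_funs_def uniformly_continuous_on_def by (auto simp: dist_commute)

lemma unif_cont_funs_const: "(\<lambda>_. c) \<in> unif_cont_funs"
  by (auto simp: unif_cont_funs_iff)

lemma unif_cont_funs_add:
  "f \<in> unif_cont_funs \<Longrightarrow> g \<in> unif_cont_funs \<Longrightarrow> (\<lambda>x. f x + g x) \<in> unif_cont_funs"
  unfolding unif_cont_funs_def by (auto intro: uniformly_continuous_on_add)

lemma unif_cont_funs_diff:
  "f \<in> unif_cont_funs \<Longrightarrow> g \<in> unif_cont_funs \<Longrightarrow> (\<lambda>x. f x - g x) \<in> unif_cont_funs"
  unfolding unif_cont_funs_def by (auto intro: uniformly_continuous_on_diff)

lemma unif_cont_funs_small_oscillation:
  assumes "f \<in> unif_cont_funs" "e > 0"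
  shows "\<exists>r>0. \<forall>z. dist x z < r \<longrightarrow> norm (f z - f x) < e"
  using assms unfolding unif_cont_funs_iff by (metis dist_norm dist_commute)

definition bump :: "'a::metric_space \<Rightarrow> real \<Rightarrow> 'a \<Rightarrow> real"
  where "bump x r z = max 0 (min 1 (2 - 2 * dist x z / r))"

definition cut :: "'a::metric_space \<Rightarrow> real \<Rightarrow> ('a \<Rightarrow> 'e::real_normed_vector) \<Rightarrow> 'a \<Rightarrow> 'e"
  where "cut x r g z = bump x r z *\<^sub>R g z"

lemma bump_bounds: "0 \<le> bump x r z" "bump x r z \<le> 1"
  by (auto simp: bump_def)

lemma bump_lipschitz:
  assumes "r > 0"
  shows "\<bar>bump x r a - bump x r b\<bar> \<le> 2 / r * dist a b"
proof -
  have clamp: "\<bar>max 0 (min 1 (2 - p)) - max 0 (min 1 (2 - q))\<bar> \<le> \<bar>p - q\<bar>" for p q :: real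
    by (simp add: max_def min_def abs_minus_commute)
  have "\<bar>bump x r a - bump x r b\<bar> \<le> \<bar>2 * dist x a / r - 2 * dist x b / r\<bar>"
    unfolding bump_def by (rule clamp)
  also have "\<dots> = 2 / r * \<bar>dist x a - dist x b\<bar>"
  proof -
    have "2 * dist x a / r - 2 * dist x b / r = 2 / r * (dist x a - dist x b)"
      by (simp add: algebra_simps diff_divide_distrib)
    then show ?thesis using assms by (simp only: abs_mult) simp
  qed
  also have "\<dots> \<le> 2 / r * dist a b"
    using assms abs_dist_diff_le [of a x b]
    by (intro mult_left_mono) (auto simp: dist_commute)
  finally show ?thesis .
qed

lemma cut_eq:
  assumes "r > 0" "dist x z \<le> r / 2"
  shows "cut x r g z = g z"
proof -
  have "2 * dist x z / r \<le> 1"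
    using assms by (simp add: field_simps)
  then show ?thesis
    by (auto simp: cut_def bump_def max_def min_def)
qed

lemma cut_zero:
  assumes "r > 0" "dist x z \<ge> r"
  shows "cut x r g z = 0"
proof -
  have "2 * dist x z / r \<ge> 2"
    using assms by (simp add: field_simps)
  then show ?thesis
    by (auto simp: cut_def bump_def max_def min_def)
qed

lemma cut_nonzeroD: "r > 0 \<Longrightarrow> cut x r g z \<noteq> 0 \<Longrightarrow> dist x z < r"
  by (meson cut_zero not_less)

lemma cut_norm_le:
  assumes "r > 0" "\<And>z. dist x z < r \<Longrightarrow> norm (g z) \<le> B" "0 \<le> B"
  shows "norm (cut x r g z) \<le> B"
proof (cases "dist x z < r")
  case True
  then have "norm (g z) \<le> B" by (rule assms)
  then show ?thesis
    using mult_mono [of "bump x r z" 1 "norm (g z)" B] bump_bounds [of x r z] \<open>0 \<le> B\<close>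
    by (simp add: cut_def)
next
  case False
  then show ?thesis using cut_zero [of r x z g] assms by simp
qed

text \<open>A product of uniformly continuous functions need not be uniformly continuous; here it is,
  because the unbounded factor is controlled on the support of the bounded one.\<close>

lemma cut_unif_cont:
  fixes x :: "'a::metric_space"
  assumes "g \<in> unif_cont_funs" "r > 0" and B: "\<And>z. dist x z < r \<Longrightarrow> norm (g z) \<le> B"
  shows "cut x r g \<in> unif_cont_funs"
  unfolding unif_cont_funs_iff
proof (intro allI impI)
  fix e :: real assume "e > 0"
  have B0: "B \<ge> 0" using B [of x] \<open>r > 0\<close> norm_ge_zero [of "g x"] by (simp del: norm_ge_zero)
  obtain d where d: "d > 0" "\<And>a b. dist a b < d \<Longrightarrow> dist (g a) (g b) < e / 2"
    using assms(1) \<open>e > 0\<close> unfolding unif_cont_funs_iff by (meson half_gt_zero)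
  define d' where "d' = min d (e / 2 / (2 / r * (B + 1)))"
  have d'0: "d' > 0" unfolding d'_def using d \<open>e > 0\<close> \<open>r > 0\<close> B0 by simp
  have main: "dist (cut x r g a) (cut x r g b) < e" if "dist a b < d'" "dist x a < r" for a b :: 'a
  proof -
    have "cut x r g a - cut x r g b
        = (bump x r a - bump x r b) *\<^sub>R g a + bump x r b *\<^sub>R (g a - g b)"
      by (simp add: cut_def algebra_simps)
    then have "dist (cut x r g a) (cut x r g b)
        \<le> \<bar>bump x r a - bump x r b\<bar> * norm (g a) + bump x r b * norm (g a - g b)"
      using norm_triangle_ineq [of "(bump x r a - bump x r b) *\<^sub>R g a" "bump x r b *\<^sub>R (g a - g b)"]
        bump_bounds [of x r b]
      by (simp add: dist_norm)
    also have "\<bar>bump x r a - bump x r b\<bar> * norm (g a) \<le> (2 / r * dist a b) * (B + 1)"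
      using bump_lipschitz [OF \<open>r > 0\<close>, of x a b] B [OF that(2)] \<open>r > 0\<close> B0
      by (intro mult_mono) auto
    also have "(2 / r * dist a b) * (B + 1) \<le> e / 2"
    proof -
      have "dist a b < e / 2 / (2 / r * (B + 1))" using that by (simp add: d'_def)
      moreover have "2 / r * (B + 1) > 0" using \<open>r > 0\<close> B0 by simp
      ultimately have "dist a b * (2 / r * (B + 1)) < e / 2"
        by (metis pos_less_divide_eq)
      then show ?thesis by (simp add: algebra_simps)
    qed
    also have "bump x r b * norm (g a - g b) \<le> 1 * norm (g a - g b)"
      using bump_bounds [of x r b] by (intro mult_right_mono) auto
    also have "1 * norm (g a - g b) < e / 2"
      using d(2) [of a b] that by (simp add: d'_def dist_norm)
    finally show ?thesis by simp
  qed
  show "\<exists>d>0. \<forall>a b. dist a b < d \<longrightarrow> dist (cut x r g a) (cut x r g b) < e"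
  proof (intro exI conjI allI impI)
    show "d' > 0" by fact
    fix a b :: 'a assume ab: "dist a b < d'"
    consider "dist x a < r" | "dist x b < r" | "dist x a \<ge> r" "dist x b \<ge> r" by linarith
    then show "dist (cut x r g a) (cut x r g b) < e"
    proof cases
      case 1 then show ?thesis using main ab by blast
    next
      case 2 then show ?thesis using main [of b a] ab by (simp add: dist_commute)
    next
      case 3 then show ?thesis using cut_zero \<open>r > 0\<close> \<open>e > 0\<close> by (metis dist_self)
    qed
  qed
qed

lemma cut_const_unif_cont: "r > 0 \<Longrightarrow> cut x r (\<lambda>_. c) \<in> unif_cont_funs"
  by (rule cut_unif_cont [where B = "norm c"]) (auto simp: unif_cont_funs_const)

text \<open>The pointwise sum of a family with disjoint cozero sets. Selecting the only possibly nonzero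
  summand avoids infinite sums and makes sense for every index type; where all members vanish, the
  arbitrary choice still yields \<open>0\<close>.\<close>

definition glue :: "('i \<Rightarrow> 'a \<Rightarrow> 'e::zero) \<Rightarrow> 'a \<Rightarrow> 'e"
  where "glue g x = g (SOME n. g n x \<noteq> 0) x"

lemma glue_zero: "(\<And>n. g n x = 0) \<Longrightarrow> glue g x = 0"
  by (simp add: glue_def)

lemma glue_cases:
  fixes g :: "'i \<Rightarrow> 'a \<Rightarrow> 'e::zero"
  shows "glue g x = 0 \<or> (\<exists>n. g n x \<noteq> 0 \<and> glue g x = g n x)"
  by (metis glue_def)

lemma glue_eq:
  fixes g :: "'i \<Rightarrow> 'a \<Rightarrow> 'e::zero"
  assumes "\<And>i j. i \<noteq> j \<Longrightarrow> g i x = 0 \<or> g j x = 0" "g n x \<noteq> 0"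
  shows "glue g x = g n x"
  unfolding glue_def using assms by (metis (mono_tags, lifting) someI)

text \<open>For two nearby points, either a single member \<open>g n\<close> gives both values, or at each of the
  points the member that is active there vanishes at the other point, so that both values are small.
  The common modulus of continuity therefore survives up to a factor of two.\<close>

lemma glue_unif_cont:
  fixes g :: "'i \<Rightarrow> 'a::metric_space \<Rightarrow> 'e::real_normed_vector"
  assumes disj: "\<And>i j x. i \<noteq> j \<Longrightarrow> g i x = 0 \<or> g j x = 0"
    and equi: "\<And>e. e > 0 \<Longrightarrow> \<exists>d>0. \<forall>n x y. dist x y < d \<longrightarrow> dist (g n x) (g n y) < e"
  shows "glue g \<in> unif_cont_funs"
  unfolding unif_cont_funs_iff
proof (intro allI impI)
  fix e :: real assume "e > 0"
  then obtain d where d: "d > 0" "\<And>n x y. dist x y < d \<Longrightarrow> dist (g n x) (g n y) < e / 2"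
    using equi by (meson half_gt_zero)
  show "\<exists>d>0. \<forall>x y. dist x y < d \<longrightarrow> dist (glue g x) (glue g y) < e"
  proof (intro exI conjI allI impI)
    show "d > 0" by fact
    fix x y :: 'a assume xy: "dist x y < d"
    have gl: "glue g z = g n z" if "g n z \<noteq> 0" for n and z :: 'a
      using glue_eq [of g z n] disj that by blast
    have *: "norm (glue g a) < e / 2 \<or> (\<exists>n. glue g a = g n a \<and> glue g b = g n b)"
      if "dist a b < d" for a b :: 'a
    proof (cases "\<exists>n. g n a \<noteq> 0")
      case True
      then obtain n where n: "g n a \<noteq> 0" by blast
      show ?thesis
      proof (cases "g n b = 0")
        case True
        then show ?thesis using d(2) [OF that, of n] gl [OF n] by simp
      next
        case False
        then show ?thesis using gl n by blast
      qed
    next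
      case False
      then show ?thesis using glue_zero [of g a] \<open>e > 0\<close> by simp
    qed
    have "norm (glue g x) < e / 2 \<and> norm (glue g y) < e / 2
        \<or> (\<exists>n. glue g x = g n x \<and> glue g y = g n y)"
      using * [of x y] * [of y x] xy by (auto simp: dist_commute)
    then show "dist (glue g x) (glue g y) < e"
    proof
      assume "norm (glue g x) < e / 2 \<and> norm (glue g y) < e / 2"
      then show ?thesis
        using norm_triangle_ineq4 [of "glue g x" "glue g y"] by (simp add: dist_norm)
    next
      assume "\<exists>n. glue g x = g n x \<and> glue g y = g n y"
      then show ?thesis using d(2) [OF xy] \<open>e > 0\<close> by (smt (verit) half_gt_zero field_sum_of_halves)
    qed
  qed
qed

text \<open>Sup norms tending to \<open>0\<close> give a common modulus of continuity: for each tolerance only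
  finitely many members have to be considered. The members may thus be arbitrarily steep.\<close>

lemma glue_vanishing_unif_cont:
  fixes g :: "nat \<Rightarrow> 'a::metric_space \<Rightarrow> 'e::real_normed_vector"
  assumes disj: "\<And>i j x. i \<noteq> j \<Longrightarrow> g i x = 0 \<or> g j x = 0"
    and uc: "\<And>n. g n \<in> unif_cont_funs"
    and le: "\<And>n x. norm (g n x) \<le> b n"
    and b: "b \<longlonglongrightarrow> 0"
  shows "glue g \<in> unif_cont_funs"
proof (rule glue_unif_cont [OF disj])
  fix e :: real assume "e > 0"
  then have "eventually (\<lambda>n. b n < e / 2) sequentially"
    using b by (intro order_tendstoD) auto
  then obtain N where N: "\<And>n. n \<ge> N \<Longrightarrow> b n < e / 2"
    by (auto simp: eventually_sequentially)
  have "\<forall>n. \<exists>d>0. \<forall>x y. dist x y < d \<longrightarrow> dist (g n x) (g n y) < e"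
    using uc \<open>e > 0\<close> unfolding unif_cont_funs_iff by blast
  then obtain d where d: "\<And>n. d n > 0"
      "\<And>n x y. dist x y < d n \<Longrightarrow> dist (g n x) (g n y) < e" by metis
  define d' where "d' = Min (insert 1 (d ` {..<N}))"
  have "d' > 0" using d(1) by (simp add: d'_def)
  moreover have "dist (g n x) (g n y) < e" if "dist x y < d'" for n x y
  proof (cases "n < N")
    case True
    then have "d' \<le> d n" unfolding d'_def by (intro Min_le) auto
    then show ?thesis using d(2) that by force
  next
    case False
    then show ?thesis
      using N [of n] le [of n x] le [of n y] norm_triangle_ineq4 [of "g n x" "g n y"]
      by (simp add: dist_norm)
  qed
  ultimately show "\<exists>d>0. \<forall>n x y. dist x y < d \<longrightarrow> dist (g n x) (g n y) < e" by blast
qed auto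

section \<open>Chains\<close>

text \<open>The chains of \<open>chain_dist\<close> and their lengths, generated step by step so that they can be
  treated by rule induction.\<close>

inductive walk :: "real \<Rightarrow> 'a::metric_space \<Rightarrow> 'a \<Rightarrow> real \<Rightarrow> bool" for e a where
  walk_refl: "walk e a a 0"
| walk_step: "walk e a b L \<Longrightarrow> dist b c \<le> e \<Longrightarrow> walk e a c (L + dist b c)"

lemma walk_nonneg: "walk e a b L \<Longrightarrow> 0 \<le> L"
  by (induction rule: walk.induct) auto

lemma walk_trans:
  assumes "walk e b c M" "walk e a b L"
  shows "walk e a c (L + M)"
  using assms
proof (induction rule: walk.induct)
  case (walk_step c M c')
  then show ?case using walk.walk_step [of e a c "L + M" c'] by (simp add: add.assoc)
qed simp

lemma walk_single: "dist a b \<le> e \<Longrightarrow> walk e a b (dist a b)"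
  using walk_step [OF walk_refl, of a b e] by simp

lemma walk_sym: "walk e a b L \<Longrightarrow> walk e b a L"
proof (induction rule: walk.induct)
  case (walk_step b L c)
  have "walk e c b (dist c b)" using walk_step by (intro walk_single) (simp add: dist_commute)
  then show ?case using walk_trans [OF walk_step(3), of c "dist c b"]
    by (simp add: dist_commute add.commute)
qed (rule walk_refl)

lemma walk_iff_chain:
  "walk e a b L \<longleftrightarrow> (\<exists>(n::nat) x. L = (\<Sum>i=1..n. dist (x (i - 1)) (x i)) \<and> x 0 = a \<and> x n = b
      \<and> (\<forall>i\<in>{1..n}. dist (x (i - 1)) (x i) \<le> e))"
proof
  assume "walk e a b L"
  then show "\<exists>(n::nat) x. L = (\<Sum>i=1..n. dist (x (i - 1)) (x i)) \<and> x 0 = a \<and> x n = b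
      \<and> (\<forall>i\<in>{1..n}. dist (x (i - 1)) (x i) \<le> e)"
  proof (induction rule: walk.induct)
    case walk_refl
    show ?case by (intro exI [of _ 0] exI [of _ "\<lambda>_. a"]) auto
  next
    case (walk_step b L c)
    then obtain n :: nat and x where x: "L = (\<Sum>i=1..n. dist (x (i - 1)) (x i))" "x 0 = a" "x n = b"
      "\<forall>i\<in>{1..n}. dist (x (i - 1)) (x i) \<le> e" by (elim exE conjE) (rule that; assumption)
    have "(\<Sum>i=1..n. dist ((x(Suc n := c)) (i - 1)) ((x(Suc n := c)) i)) = L"
      unfolding x(1) by (intro sum.cong) auto
    then show ?case
      using x walk_step(2) by (intro exI [of _ "Suc n"] exI [of _ "x(Suc n := c)"]) auto
  qed
next
  assume "\<exists>(n::nat) x. L = (\<Sum>i=1..n. dist (x (i - 1)) (x i)) \<and> x 0 = a \<and> x n = b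
      \<and> (\<forall>i\<in>{1..n}. dist (x (i - 1)) (x i) \<le> e)"
  then obtain n :: nat and x where x: "L = (\<Sum>i=1..n. dist (x (i - 1)) (x i))" "x 0 = a" "x n = b"
    "\<forall>i\<in>{1..n}. dist (x (i - 1)) (x i) \<le> e" by blast
  have "walk e (x 0) (x n) (\<Sum>i=1..n. dist (x (i - 1)) (x i))"
    if "\<forall>i\<in>{1..n}. dist (x (i - 1)) (x i) \<le> e" for n
    using that
  proof (induction n)
    case (Suc n)
    then have "walk e (x 0) (x n) (\<Sum>i=1..n. dist (x (i - 1)) (x i))" "dist (x n) (x (Suc n)) \<le> e"
      by (auto dest: bspec [of _ _ "Suc n"])
    from walk_step [OF this] show ?case by simp
  qed (simp add: walk_refl)
  then show "walk e a b L" using x by metis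
qed

lemma chain_dist_eq: "chain_dist UNIV e a b = Inf {ereal L |L. walk e a b L}"
  unfolding chain_dist_def walk_iff_chain by (rule arg_cong [where f = Inf]) auto

lemma chain_dist_finite_iff: "chain_dist UNIV e a b < \<infinity> \<longleftrightarrow> (\<exists>L. walk e a b L)"
  unfolding chain_dist_eq Inf_less_iff by auto

lemma chain_dist_le: "walk e a b L \<Longrightarrow> chain_dist UNIV e a b \<le> ereal L"
  unfolding chain_dist_eq by (intro Inf_lower) auto

definition reachable :: "real \<Rightarrow> ('a::metric_space \<times> 'a) set"
  where "reachable e = {(a, b). \<exists>L. walk e a b L}"

lemma eps_sets_eq: "eps_sets UNIV e = UNIV // reachable e"
  unfolding eps_sets_def reachable_def chain_dist_finite_iff by simp

lemma equiv_reachable: "equiv UNIV (reachable e)"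
  by (rule equivI)
    (auto simp: reachable_def refl_on_def sym_def trans_def intro: walk_refl walk_sym walk_trans)

lemma reachable_if_close: "dist a b \<le> e \<Longrightarrow> (a, b) \<in> reachable e"
  using walk_single by (auto simp: reachable_def)

text \<open>A real-valued chain distance on the whole space. On points that no chain joins to \<open>a\<close> it has
  the value \<open>Inf {}\<close>; this constant is harmless, since such points form a union of \<open>e\<close>-sets and are
  therefore at distance more than \<open>e\<close> from all others.\<close>

definition walk_dist :: "real \<Rightarrow> 'a::metric_space \<Rightarrow> 'a \<Rightarrow> real"
  where "walk_dist e a b = Inf {L. walk e a b L}"

lemma walk_dist_step:
  assumes "dist b c \<le> e"
  shows "walk_dist e a c \<le> walk_dist e a b + dist b c"
proof (cases "\<exists>L. walk e a b L")
  case True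
  have "walk_dist e a c - dist b c \<le> walk_dist e a b"
    unfolding walk_dist_def [of e a b]
  proof (rule cInf_greatest)
    fix L assume "L \<in> {L. walk e a b L}"
    then have "walk e a c (L + dist b c)" using assms by (auto intro: walk_step)
    then have "walk_dist e a c \<le> L + dist b c"
      unfolding walk_dist_def by (intro cInf_lower bdd_belowI [of _ 0]) (auto dest: walk_nonneg)
    then show "walk_dist e a c - dist b c \<le> L" by simp
  qed (use True in auto)
  then show ?thesis by simp
next
  case False
  have "\<not> (\<exists>L. walk e a c L)"
  proof
    assume "\<exists>L. walk e a c L"
    then obtain L where "walk e a c L" by blast
    then have "walk e a b (L + dist c b)"
      using assms by (intro walk_step) (auto simp: dist_commute)
    then show False using False by blast
  qed
  then show ?thesis using False by (simp add: walk_dist_def)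
qed

lemma walk_dist_unif_cont:
  assumes "e > 0"
  shows "walk_dist e a \<in> unif_cont_funs"
  unfolding unif_cont_funs_iff
proof (intro allI impI)
  fix k :: real assume "k > 0"
  have "dist (walk_dist e a b) (walk_dist e a c) < k" if "dist b c < min e k" for b c
    using that walk_dist_step [of b c e a] walk_dist_step [of c b e a]
    by (simp add: dist_real_def dist_commute [of c b] abs_less_iff)
  then show "\<exists>d>0. \<forall>b c. dist b c < d \<longrightarrow> dist (walk_dist e a b) (walk_dist e a c) < k"
    using assms \<open>k > 0\<close> by (intro exI [of _ "min e k"]) auto
qed

text \<open>In the second case \<open>D\<close> is the chain distance from a point of an unbounded \<open>\<epsilon>\<close>-set.\<close>

lemma not_bourbaki_bounded_cases:
  assumes "\<not> bourbaki_bounded (UNIV :: 'a::metric_space set)"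
  obtains (many) e where "e > 0" "infinite (eps_sets (UNIV :: 'a::metric_space set) e)"
  | (far) D :: "'a::metric_space \<Rightarrow> real" where "D \<in> unif_cont_funs" "\<And>M. \<exists>x. D x > M"
proof -
  obtain e where e: "e > 0" "infinite (eps_sets (UNIV :: 'a set) e) \<or>
      (\<exists>S\<in>eps_sets (UNIV :: 'a set) e. \<forall>M::real. \<exists>a\<in>S. \<exists>b\<in>S. \<not> chain_dist UNIV e a b \<le> ereal M)"
    using assms unfolding bourbaki_bounded_def by blast
  from e(2) show thesis
  proof
    assume "infinite (eps_sets (UNIV :: 'a set) e)"
    then show thesis using many e by blast
  next
    assume "\<exists>S\<in>eps_sets (UNIV :: 'a set) e. \<forall>M::real. \<exists>a\<in>S. \<exists>b\<in>S. \<not> chain_dist UNIV e a b \<le> ereal M"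
    then obtain S where S: "S \<in> eps_sets (UNIV :: 'a set) e"
      "\<And>M::real. \<exists>a\<in>S. \<exists>b\<in>S. \<not> chain_dist UNIV e a b \<le> ereal M" by blast
    then obtain c where c: "S = reachable e `` {c}"
      unfolding eps_sets_eq by (auto elim: quotientE)
    have "\<exists>x. walk_dist e c x > M" for M
    proof (rule ccontr)
      assume "\<not> (\<exists>x. walk_dist e c x > M)"
      then have M: "walk_dist e c x < M + 1" for x by (smt (verit))
      have short: "\<exists>L<M + 1. walk e c x L" if "x \<in> S" for x
      proof -
        have "{L. walk e c x L} \<noteq> {}" using that c by (auto simp: reachable_def)
        then show ?thesis using cInf_lessD [of "{L. walk e c x L}" "M + 1"] M [of x]
          by (auto simp: walk_dist_def)
      qed
      obtain a b where ab: "a \<in> S" "b \<in> S" "\<not> chain_dist UNIV e a b \<le> ereal (2 * (M + 1))"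
        using S(2) by blast
      obtain L L' where L: "L < M + 1" "walk e c a L" "L' < M + 1" "walk e c b L'"
        using short ab by meson
      have "chain_dist UNIV e a b \<le> ereal (L + L')"
        using L by (intro chain_dist_le walk_trans [of e c b L' a L]) (auto intro: walk_sym)
      also have "\<dots> \<le> ereal (2 * (M + 1))" using L by simp
      finally show False using ab by blast
    qed
    then show thesis using far walk_dist_unif_cont [OF e(1)] by blast
  qed
qed

text \<open>A point without other points at distance \<open>\<le> e\<close> is an \<open>e\<close>-set by itself.\<close>

lemma eventually_not_isolated:
  fixes x :: "nat \<Rightarrow> 'a::metric_space"
  assumes "finite (eps_sets (UNIV :: 'a set) e)" "inj x"
  shows "eventually (\<lambda>n. \<exists>z. z \<noteq> x n \<and> dist (x n) z \<le> e) sequentially"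
proof -
  define B where "B = {n. \<forall>z. dist (x n) z \<le> e \<longrightarrow> z = x n}"
  have stay: "y = x n" if "n \<in> B" "walk e (x n) y L" for n y L
    using that(2) by induction (use that(1) in \<open>auto simp: B_def\<close>)
  have "reachable e `` {x n} = {x n}" if "n \<in> B" for n
    using stay [OF that] walk_refl [of e "x n"] by (auto simp: reachable_def)
  then have "(\<lambda>n. {x n}) ` B \<subseteq> eps_sets UNIV e"
    unfolding eps_sets_eq by (force simp: quotient_def)
  then have "finite ((\<lambda>n. {x n}) ` B)" using assms(1) finite_subset by blast
  moreover have "inj_on (\<lambda>n. {x n}) B" using assms(2) by (auto simp: inj_on_def)
  ultimately have "finite B" by (rule finite_imageD)
  then obtain N where "\<And>n. n \<in> B \<Longrightarrow> n < N"
    using finite_nat_iff_bounded by auto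
  then have "\<forall>n\<ge>N. n \<notin> B" by (meson not_less)
  then show ?thesis unfolding eventually_sequentially B_def by blast
qed

section \<open>Biseparating maps\<close>

locale biseparating_unif =
  fixes T :: "('a::metric_space \<Rightarrow> 'e::real_normed_vector) \<Rightarrow> ('b::metric_space \<Rightarrow> 'f::real_normed_vector)"
    and u :: 'e and v :: 'f
  assumes u: "u \<noteq> 0" and v: "v \<noteq> 0"
    and bisep: "biseparating unif_cont_funs bdd_unif_cont_funs T"
begin

lemma bij: "bij_betw T unif_cont_funs bdd_unif_cont_funs"
  using bisep by (simp add: biseparating_def)

lemma separates:
  assumes "f \<in> unif_cont_funs" "g \<in> unif_cont_funs" "h \<in> unif_cont_funs"
    "\<And>z. f z = h z \<or> g z = h z"
  shows "T f y = T h y \<or> T g y = T h y"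
proof -
  have "perp h f g" using assms(4) by (auto simp: perp_def cozero_def)
  then have "perp (T h) (T f) (T g)" using bisep assms(1-3) by (auto simp: biseparating_def)
  then show ?thesis by (auto simp: perp_def cozero_def)
qed

lemma separates_back:
  assumes "f \<in> unif_cont_funs" "g \<in> unif_cont_funs" "h \<in> unif_cont_funs"
    "\<And>y. T f y = T h y \<or> T g y = T h y"
  shows "f z = h z \<or> g z = h z"
proof -
  have "perp (T h) (T f) (T g)" using assms(4) by (auto simp: perp_def cozero_def)
  then have "perp h f g" using bisep assms(1-3) by (auto simp: biseparating_def)
  then show ?thesis by (auto simp: perp_def cozero_def)
qed

lemma T_bdd: "f \<in> unif_cont_funs \<Longrightarrow> T f \<in> bdd_unif_cont_funs"
  using bij by (auto simp: bij_betw_def)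

lemma T_continuous: "f \<in> unif_cont_funs \<Longrightarrow> continuous_on UNIV (T f)"
  using T_bdd [of f] by (auto simp: bdd_unif_cont_funs_def intro: uniformly_continuous_imp_continuous)

definition pre :: "('b \<Rightarrow> 'f) \<Rightarrow> 'a \<Rightarrow> 'e"
  where "pre g = inv_into unif_cont_funs T g"

lemma pre: "g \<in> bdd_unif_cont_funs \<Longrightarrow> pre g \<in> unif_cont_funs" "g \<in> bdd_unif_cont_funs \<Longrightarrow> T (pre g) = g"
  using bij by (auto simp: pre_def bij_betw_def inv_into_into f_inv_into_f)

definition level :: "real \<Rightarrow> 'a \<Rightarrow> 'e"
  where "level s = pre (\<lambda>_. s *\<^sub>R v)"

lemma level: "level s \<in> unif_cont_funs" "T (level s) = (\<lambda>_. s *\<^sub>R v)"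
proof -
  have "(\<lambda>_. s *\<^sub>R v) \<in> (bdd_unif_cont_funs :: ('b \<Rightarrow> 'f) set)"
    using unif_cont_funs_const by (auto simp: bdd_unif_cont_funs_def unif_cont_funs_def)
  then show "level s \<in> unif_cont_funs" "T (level s) = (\<lambda>_. s *\<^sub>R v)"
    unfolding level_def by (auto intro: pre)
qed

definition spike :: "'a \<Rightarrow> real \<Rightarrow> 'a \<Rightarrow> 'e"
  where "spike x r = cut x r (\<lambda>_. u)"

lemma spike:
  assumes "r > 0"
  shows "spike x r \<in> unif_cont_funs" "spike x r x \<noteq> 0" "spike x r z \<noteq> 0 \<Longrightarrow> dist x z < r"
  using assms u by (auto simp: spike_def cut_eq cut_const_unif_cont dest: cut_nonzeroD)

lemma spike_moves:
  assumes "h \<in> unif_cont_funs" "r > 0"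
  shows "\<exists>y. T (\<lambda>z. h z + spike x r z) y \<noteq> T h y"
proof (rule ccontr)
  assume "\<not> ?thesis"
  then have "T (\<lambda>z. h z + spike x r z) = T h" by auto
  then have "(\<lambda>z. h z + spike x r z) = h"
    using bij assms by (auto simp: bij_betw_def dest!: inj_onD intro: unif_cont_funs_add spike)
  then have "h x + spike x r x = h x" by metis
  then show False using spike(2) [OF assms(2)] by simp
qed

text \<open>The basic locality principle. The points where \<open>T\<close> notices the perturbation \<open>k\<close> of the base
  \<open>h\<close> play the role of the image of the support of \<open>k\<close> under a point map between the two
  spaces.\<close>

lemma agree_on_moved:
  assumes "f \<in> unif_cont_funs" "h \<in> unif_cont_funs" "k \<in> unif_cont_funs"
    "\<And>z. k z \<noteq> 0 \<Longrightarrow> f z = h z" "T (\<lambda>z. h z + k z) y \<noteq> T h y"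
  shows "T f y = T h y"
  using separates [of f "\<lambda>z. h z + k z" h y] assms by (auto intro: unif_cont_funs_add)

text \<open>The same locality for another base \<open>h'\<close>: the points where \<open>T\<close> notices a perturbation of \<open>h\<close>
  near \<open>x\<close> also lie over \<open>x\<close> from the viewpoint of \<open>h'\<close>. The two bases are linked by \<open>h2\<close>, which is
  \<open>h\<close> on the support of \<open>k\<close> and \<open>h'\<close> outside the ball; \<open>p\<close> is the same modification of \<open>q\<close>.
  Over the support of \<open>k\<close> the images of \<open>p\<close> and \<open>h2\<close> agree, and the separation conditions for the
  quadruple \<open>h', q, h2, p\<close> pass this on to \<open>q\<close> and \<open>h'\<close>.\<close>

lemma moved_independent_of_base:
  assumes h: "h \<in> unif_cont_funs" and h': "h' \<in> unif_cont_funs" and q: "q \<in> unif_cont_funs"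
    and k: "k \<in> unif_cont_funs" and r: "r > 0"
    and B: "\<And>z. dist x z < r \<Longrightarrow> norm (h z - h' z) \<le> B"
    and k0: "\<And>z. k z \<noteq> 0 \<Longrightarrow> dist x z < r / 2"
    and qh': "\<And>z. dist x z < r \<Longrightarrow> q z = h' z"
    and y: "T (\<lambda>z. h z + k z) y \<noteq> T h y"
  shows "T q y = T h' y"
proof -
  define c where "c = cut x r (\<lambda>z. h z - h' z)"
  have c: "c \<in> unif_cont_funs"
    unfolding c_def using h h' r B by (intro cut_unif_cont unif_cont_funs_diff)
  have c1: "c z = h z - h' z" if "k z \<noteq> 0" for z
    unfolding c_def using k0 [OF that] r by (intro cut_eq) auto
  have c0: "q z = h' z \<or> c z = 0" for z
    using cut_zero [OF r, of x z] qh' [of z] unfolding c_def by (cases "dist x z < r") auto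
  define h2 where "h2 = (\<lambda>z. h' z + c z)"
  define p where "p = (\<lambda>z. q z + c z)"
  have uc: "h2 \<in> unif_cont_funs" "p \<in> unif_cont_funs"
    "(\<lambda>z. h z + k z) \<in> unif_cont_funs" "(\<lambda>z. h2 z + k z) \<in> unif_cont_funs"
    unfolding h2_def p_def using h h' q k c by (auto intro!: unif_cont_funs_add)
  have h2h: "h2 z = h z" if "k z \<noteq> 0" for z
    using c1 [OF that] by (simp add: h2_def)
  have 1: "T h2 y = T h y"
    using agree_on_moved [OF uc(1) h k h2h y] by simp
  have "T h y = T (\<lambda>z. h z + k z) y \<or> T (\<lambda>z. h2 z + k z) y = T (\<lambda>z. h z + k z) y"
    using h2h by (intro separates uc h) force
  then have 2: "T (\<lambda>z. h2 z + k z) y \<noteq> T h2 y" using y 1 by auto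
  have "p z = h2 z" if "k z \<noteq> 0" for z
    using qh' [of z] k0 [OF that] r by (simp add: p_def h2_def)
  then have 3: "T p y = T h2 y"
    by (intro agree_on_moved [OF uc(2) uc(1) k _ 2])
  have 4: "T q y = T h' y \<or> T h2 y = T h' y"
    using c0 by (intro separates q uc h') (simp add: h2_def)
  have 5: "T h' y = T q y \<or> T p y = T q y"
    using c0 by (intro separates q uc h') (metis add.right_neutral p_def)
  from 3 4 5 show ?thesis by auto
qed

text \<open>Near each \<open>x n\<close> the difference \<open>level n - P\<close> is as small as desired because it vanishes at
  \<open>x n\<close>. Adding cut-offs of these differences, with sup norms tending to \<open>0\<close>, makes \<open>P\<close> coincide
  with \<open>level n\<close> near \<open>x n\<close>, and then its image under \<open>T\<close> attains all the values \<open>n v\<close>.\<close>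

lemma no_interpolation:
  fixes x :: "nat \<Rightarrow> 'a"
  assumes \<delta>: "\<delta> > 0" and sep: "\<And>i j. i \<noteq> j \<Longrightarrow> \<delta> \<le> dist (x i) (x j)"
    and P: "P \<in> unif_cont_funs" and Px: "\<And>n. P (x n) = level (real n) (x n)"
  shows False
proof -
  have "\<exists>r>0. r \<le> \<delta> / 2 \<and> (\<forall>z. dist (x n) z < r \<longrightarrow>
      norm (level (real n) z - P z) \<le> 1 / (real n + 1))" for n
  proof -
    obtain r where "r > 0" "\<forall>z. dist (x n) z < r \<longrightarrow>
        norm ((level (real n) z - P z) - (level (real n) (x n) - P (x n))) < 1 / (real n + 1)"
      using unif_cont_funs_small_oscillation [OF unif_cont_funs_diff [OF level(1) P], of "1 / (real n + 1)" "x n" "real n"]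
      by auto
    then show ?thesis
      using \<delta> Px by (intro exI [of _ "min r (\<delta> / 2)"]) (auto intro: less_imp_le)
  qed
  then obtain r where r: "\<And>n. r n > 0" "\<And>n. r n \<le> \<delta> / 2"
    "\<And>n z. dist (x n) z < r n \<Longrightarrow> norm (level (real n) z - P z) \<le> 1 / (real n + 1)"
    by metis
  define c where "c n = cut (x n) (r n) (\<lambda>z. level (real n) z - P z)" for n
  have disj: "c i z = 0 \<or> c j z = 0" if "i \<noteq> j" for i j z
  proof (rule ccontr)
    assume "\<not> ?thesis"
    then have "dist (x i) z < r i" "dist (x j) z < r j"
      unfolding c_def using r(1) by (auto dest: cut_nonzeroD)
    then show False
      using sep [OF that] r(2) [of i] r(2) [of j] dist_triangle2 [of "x i" "x j" z] by simp
  qed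
  have cuc: "c n \<in> unif_cont_funs" for n
    unfolding c_def by (intro cut_unif_cont [where B = "1 / (real n + 1)"] r unif_cont_funs_diff level P)
  have cle: "norm (c n z) \<le> 1 / (real n + 1)" for n z
    unfolding c_def by (intro cut_norm_le r) auto
  have lim: "(\<lambda>n. 1 / (real n + 1)) \<longlonglongrightarrow> 0"
    using LIMSEQ_inverse_real_of_nat by (simp add: inverse_eq_divide add.commute)
  define f where "f = (\<lambda>z. P z + glue c z)"
  have f: "f \<in> unif_cont_funs"
    unfolding f_def by (intro unif_cont_funs_add P glue_vanishing_unif_cont [OF disj cuc cle lim])
  have feq: "f z = level (real n) z" if "dist (x n) z < r n / 2" for n z
  proof -
    have c: "c n z = level (real n) z - P z"
      unfolding c_def using that r(1) by (intro cut_eq) auto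
    show ?thesis
    proof (cases "c n z = 0")
      case True
      have "c m z = 0" for m
      proof (cases "m = n")
        case False
        have "dist (x m) z \<ge> r m"
          using sep [OF False] r(2) [of m] r(2) [of n] that r(1) [of n] dist_triangle2 [of "x m" "x n" z]
          by simp
        then show ?thesis unfolding c_def using r(1) by (intro cut_zero)
      qed (use True in simp)
      then show ?thesis using True c by (simp add: f_def glue_zero)
    next
      case False
      then show ?thesis using glue_eq [of c z n] disj c by (simp add: f_def)
    qed
  qed
  have large: "\<exists>y. T f y = real n *\<^sub>R v" for n
  proof -
    obtain y where y: "T (\<lambda>z. level (real n) z + spike (x n) (r n / 2) z) y \<noteq> T (level (real n)) y"
      using spike_moves [OF level(1)] r(1) by (meson half_gt_zero)
    have "T f y = T (level (real n)) y"
      using r(1) [of n] spike [of "r n / 2" "x n"]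
      by (intro agree_on_moved [OF f level(1) _ _ y]) (auto intro: feq)
    then show ?thesis by (auto simp: level)
  qed
  obtain M where M: "\<And>y. norm (T f y) \<le> M"
    using T_bdd [OF f] by (auto simp: bdd_unif_cont_funs_def bounded_iff)
  obtain n :: nat where "real n > M / norm v" using reals_Archimedean2 by blast
  then have "real n * norm v > M" using v by (simp add: field_simps)
  moreover obtain y where "T f y = real n *\<^sub>R v" using large by blast
  ultimately show False using M [of y] by simp
qed

text \<open>Continuity of \<open>level\<close> in its parameter, along a separated sequence whose points are nearly
  non-isolated. The points \<open>z n\<close> near \<open>x n\<close> transfer information: the preimage \<open>f\<close> of a function
  with bumps of height \<open>t n - s\<close> equals \<open>level s\<close> at \<open>z n\<close>, it equals \<open>level (t n)\<close> at a point at
  least as close to \<open>x n\<close>, and it is uniformly continuous.\<close>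

lemma levels_close_somewhere:
  fixes x :: "nat \<Rightarrow> 'a"
  assumes \<delta>: "\<delta> > 0" and sep: "\<And>i j. i \<noteq> j \<Longrightarrow> \<delta> \<le> dist (x i) (x j)"
    and z: "\<And>n. z n \<noteq> x n" "\<And>n. dist (x n) (z n) < \<delta> / 4" "(\<lambda>n. dist (x n) (z n)) \<longlonglongrightarrow> 0"
    and t: "t \<longlonglongrightarrow> s"
  shows "\<exists>n. norm (level (t n) (x n) - level s (x n)) \<le> 1"
proof -
  define h where "h = level s"
  define l where "l n = level (t n)" for n
  have h: "h \<in> unif_cont_funs" "T h = (\<lambda>_. s *\<^sub>R v)" unfolding h_def by (auto simp: level)
  have l: "l n \<in> unif_cont_funs" "T (l n) = (\<lambda>_. t n *\<^sub>R v)" for n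
    unfolding l_def by (auto simp: level)
  have "\<exists>r>0. r < dist (x n) (z n) \<and> (\<forall>w. dist (x n) w \<le> r \<longrightarrow>
      norm (h w - h (x n)) < 1 / 3 \<and> norm (l n w - l n (x n)) < 1 / 3)" for n
  proof -
    obtain r1 where r1: "r1 > 0" "\<And>w. dist (x n) w < r1 \<Longrightarrow> norm (h w - h (x n)) < 1 / 3"
      using unif_cont_funs_small_oscillation [OF h(1), of "1 / 3" "x n"] by auto
    obtain r2 where r2: "r2 > 0" "\<And>w. dist (x n) w < r2 \<Longrightarrow> norm (l n w - l n (x n)) < 1 / 3"
      using unif_cont_funs_small_oscillation [OF l(1), of "1 / 3" "x n" n] by auto
    have zn: "dist (x n) (z n) > 0" using z(1) [of n] by (metis zero_less_dist_iff)
    define r where "r = min (min r1 r2) (dist (x n) (z n)) / 2"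
    have "r > 0" "r < r1" "r < r2" "r < dist (x n) (z n)"
      using r1(1) r2(1) zn by (auto simp: r_def min_def)
    then show ?thesis using r1(2) r2(2) by (intro exI [of _ r]) auto
  qed
  then obtain r where r: "\<And>n. r n > 0" "\<And>n. r n < dist (x n) (z n)"
    "\<And>n w. dist (x n) w \<le> r n \<Longrightarrow> norm (h w - h (x n)) < 1 / 3"
    "\<And>n w. dist (x n) w \<le> r n \<Longrightarrow> norm (l n w - l n (x n)) < 1 / 3"
    by metis
  define k where "k n = spike (x n) (r n / 2)" for n
  have k: "k n \<in> unif_cont_funs" "k n w \<noteq> 0 \<Longrightarrow> dist (x n) w < r n / 2"
    for n w
    unfolding k_def using spike(1,3) [of "r n / 2" "x n"] r(1) [of n] by auto
  have hk: "(\<lambda>w. h w + k n w) \<in> unif_cont_funs" for n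
    by (intro unif_cont_funs_add h k)
  \<comment> \<open>Disjoint open sets \<open>W n\<close> in the other space that lie over the balls around the \<open>x n\<close>.\<close>
  define W where "W n = {w. T (\<lambda>z. h z + k n z) w \<noteq> T h w}" for n
  have "\<exists>y \<rho>. \<rho> > 0 \<and> (\<forall>w. dist y w < \<rho> \<longrightarrow> w \<in> W n)" for n
  proof -
    have "open (W n)" unfolding W_def by (intro open_Collect_neq T_continuous h hk)
    moreover obtain y where "y \<in> W n"
      using spike_moves [OF h(1), of "r n / 2" "x n"] r(1) [of n] by (auto simp: W_def k_def)
    ultimately show ?thesis unfolding open_dist by (metis dist_commute)
  qed
  then obtain y \<rho> where \<rho>: "\<And>n. \<rho> n > 0" "\<And>n w. dist (y n) w < \<rho> n \<Longrightarrow> w \<in> W n"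
    by metis
  have Wdisj: "w \<notin> W i \<or> w \<notin> W j" if "i \<noteq> j" for i j w
  proof -
    have "k i z' = 0 \<or> k j z' = 0" for z'
    proof (rule ccontr)
      assume "\<not> ?thesis"
      then have "dist (x i) z' < r i / 2" "dist (x j) z' < r j / 2" using k(2) by auto
      then show False
        using sep [OF that] r(1,2) [of i] r(1,2) [of j] z(2) [of i] z(2) [of j]
          dist_triangle2 [of "x i" "x j" z'] by simp
    qed
    then have "T (\<lambda>w. h w + k i w) w = T h w \<or> T (\<lambda>w. h w + k j w) w = T h w"
      by (intro separates hk h) auto
    then show ?thesis by (auto simp: W_def)
  qed
  define c where "c n = cut (y n) (\<rho> n) (\<lambda>_. (t n - s) *\<^sub>R v)" for n
  have cW: "w \<in> W n" if "c n w \<noteq> 0" for n w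
    using that \<rho> unfolding c_def by (auto dest: cut_nonzeroD)
  have cdisj: "c i w = 0 \<or> c j w = 0" if "i \<noteq> j" for i j w
    using cW Wdisj [OF that] by blast
  have cle: "norm (c n w) \<le> \<bar>t n - s\<bar> * norm v" for n w
    unfolding c_def by (intro cut_norm_le \<rho>) auto
  have lim: "(\<lambda>n. \<bar>t n - s\<bar> * norm v) \<longlonglongrightarrow> 0"
  proof -
    have "(\<lambda>n. \<bar>t n - s\<bar> * norm v) \<longlonglongrightarrow> \<bar>s - s\<bar> * norm v"
      by (intro tendsto_intros t)
    then show ?thesis by simp
  qed
  define g where "g = (\<lambda>w. s *\<^sub>R v + glue c w)"
  have g: "g \<in> bdd_unif_cont_funs"
  proof -
    have "glue c \<in> unif_cont_funs"
      using \<rho> by (intro glue_vanishing_unif_cont [OF cdisj _ cle lim]) (auto simp: c_def cut_const_unif_cont)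
    then have "g \<in> unif_cont_funs"
      unfolding g_def by (intro unif_cont_funs_add unif_cont_funs_const)
    moreover obtain B where B: "\<And>n. norm (\<bar>t n - s\<bar> * norm v) \<le> B"
      using convergent_imp_Bseq [OF convergentI [OF lim]] unfolding Bseq_def by blast
    have "norm (glue c w) \<le> B" for w
    proof (cases "glue c w = 0")
      case True
      then show ?thesis using B [of 0] norm_ge_zero order_trans by (metis norm_zero)
    next
      case False
      then obtain n where "glue c w = c n w" using glue_cases by metis
      then show ?thesis using cle [of n w] B [of n] by simp
    qed
    then have "norm (g w) \<le> norm (s *\<^sub>R v) + B" for w
      unfolding g_def by (meson norm_triangle_ineq add_left_mono order_trans)
    then have "bounded (range g)" by (auto simp: bounded_iff)
    ultimately show ?thesis by (simp add: bdd_unif_cont_funs_def unif_cont_funs_def)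
  qed
  define f where "f = pre g"
  have f: "f \<in> unif_cont_funs" "T f = g" unfolding f_def using pre g by auto
  \<comment> \<open>Away from all balls \<open>f\<close> is still \<open>level s\<close>: a spike added to \<open>level s\<close> at \<open>z n\<close> is invisible
    on every \<open>W j\<close>, and everywhere else \<open>g\<close> equals \<open>s v\<close>.\<close>
  have fz: "f (z n) = h (z n)" for n
  proof -
    define d where "d = dist (x n) (z n) - r n"
    have d: "d > 0" using r by (simp add: d_def)
    define q where "q = (\<lambda>w. h w + spike (z n) d w)"
    have q: "q \<in> unif_cont_funs" unfolding q_def by (intro unif_cont_funs_add h spike d)
    have "q w = h w" if "k j w \<noteq> 0" for j w
    proof -
      have w: "dist (x j) w < r j / 2" using k(2) that by blast
      have "\<not> dist (z n) w < d"
      proof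
        assume dw: "dist (z n) w < d"
        show False
        proof (cases "j = n")
          case True
          then show False using w dw r(1) [of n] dist_triangle2 [of "x n" "z n" w] by (simp add: d_def)
        next
          case False
          show False
            using sep [OF False] w dw r(1,2) [of n] r(1,2) [of j] z(2) [of n] z(2) [of j]
              dist_triangle2 [of "x j" "z n" w] dist_triangle [of "x j" "x n" "z n"]
            by (simp add: d_def dist_commute)
        qed
      qed
      then show ?thesis using spike(3) [OF d] by (auto simp: q_def)
    qed
    then have qW: "T q w = T h w" if "w \<in> W j" for j w
      using that agree_on_moved [OF q h(1) k(1)] by (auto simp: W_def)
    have "T q w = T h w \<or> T f w = T h w" for w
    proof (cases "\<exists>j. w \<in> W j")
      case False
      then have "glue c w = 0" using cW by (blast intro: glue_zero)
      then show ?thesis by (simp add: f h g_def)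
    qed (use qW in blast)
    then have "q (z n) = h (z n) \<or> f (z n) = h (z n)"
      by (intro separates_back q f h)
    then show ?thesis using spike(2) [OF d] by (auto simp: q_def)
  qed
  \<comment> \<open>On half the ball around \<open>y n\<close> the function \<open>g\<close> equals \<open>t n v\<close>. A bump \<open>g'\<close> over this constant
    has a preimage different from \<open>level (t n)\<close>; where they differ, \<open>f\<close> equals \<open>level (t n)\<close>. Such a
    point lies close to \<open>x n\<close> because a spike further away leaves \<open>T\<close> unchanged on \<open>W n\<close>; the base
    is now \<open>level (t n)\<close>, whereas \<open>W n\<close> was defined with base \<open>level s\<close>.\<close>
  have fx: "\<exists>w. dist (x n) w \<le> r n \<and> f w = l n w" for n
  proof -
    define g' where "g' = (\<lambda>w. t n *\<^sub>R v + cut (y n) (\<rho> n / 2) (\<lambda>_. v) w)"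
    have \<rho>2: "\<rho> n / 2 > 0" using \<rho>(1) by simp
    have "g' \<in> unif_cont_funs"
      unfolding g'_def by (intro unif_cont_funs_add unif_cont_funs_const cut_const_unif_cont \<rho>2)
    moreover have "norm (g' w) \<le> norm (t n *\<^sub>R v) + norm v" for w
      unfolding g'_def by (intro norm_triangle_mono cut_norm_le \<rho>2) auto
    ultimately have g': "g' \<in> bdd_unif_cont_funs"
      by (auto simp: bdd_unif_cont_funs_def unif_cont_funs_def bounded_iff)
    define f' where "f' = pre g'"
    have f': "f' \<in> unif_cont_funs" "T f' = g'" unfolding f'_def using pre g' by auto
    have "g' (y n) \<noteq> t n *\<^sub>R v" using v \<rho>2 by (simp add: g'_def cut_eq)
    then have "f' \<noteq> l n" using f' l by metis
    then obtain w where w: "f' w \<noteq> l n w" by blast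
    have g'0: "g' a = t n *\<^sub>R v" if "\<not> dist (y n) a < \<rho> n / 2" for a
      using that \<rho>2 by (simp add: g'_def cut_zero)
    have "T f a = T (l n) a \<or> T f' a = T (l n) a" for a
    proof (cases "dist (y n) a < \<rho> n / 2")
      case True
      then have ca: "c n a = (t n - s) *\<^sub>R v" unfolding c_def using \<rho>(1) by (intro cut_eq) auto
      have "glue c a = c n a"
      proof (cases "c n a = 0")
        case True
        have "a \<in> W n" using \<open>dist (y n) a < \<rho> n / 2\<close> \<rho>(1) [of n] by (intro \<rho>(2)) linarith
        then have "c m a = 0" for m using True cW [of m a] Wdisj [of m n a] by blast
        then show ?thesis by (simp add: glue_zero)
      next
        case False
        then show ?thesis using cdisj by (intro glue_eq) auto
      qed
      then have "g a = t n *\<^sub>R v" using ca by (simp add: g_def algebra_simps)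
      then show ?thesis by (simp add: f l)
    next
      case False
      then show ?thesis using g'0 by (simp add: f' l)
    qed
    then have "f w = l n w \<or> f' w = l n w" by (intro separates_back f f' l)
    then have fw: "f w = l n w" using w by blast
    have "dist (x n) w \<le> r n"
    proof (rule ccontr)
      assume "\<not> dist (x n) w \<le> r n"
      then have d: "dist (x n) w - r n > 0" by simp
      define q where "q = (\<lambda>a. l n a + spike w (dist (x n) w - r n) a)"
      have q: "q \<in> unif_cont_funs" unfolding q_def by (intro unif_cont_funs_add l spike d)
      have ql: "q a = l n a" if "dist (x n) a < r n" for a
      proof -
        have "\<not> dist w a < dist (x n) w - r n"
          using that dist_triangle2 [of "x n" w a] by linarith
        then show ?thesis using spike(3) [OF d] by (auto simp: q_def)
      qed
      have close: "norm (h a - l n a) \<le> norm (h (x n) - l n (x n)) + 1" if "dist (x n) a < r n" for a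
      proof -
        have "norm (h a - l n a) = norm ((h (x n) - l n (x n)) + ((h a - h (x n)) - (l n a - l n (x n))))"
          by (simp add: algebra_simps)
        also have "\<dots> \<le> norm (h (x n) - l n (x n)) + (norm (h a - h (x n)) + norm (l n a - l n (x n)))"
          by (meson norm_triangle_ineq norm_triangle_ineq4 add_left_mono order_trans)
        finally show ?thesis using r(3,4) [of n a] that by linarith
      qed
      have "T q a = T (l n) a" if "a \<in> W n" for a
      proof (rule moved_independent_of_base [OF h(1) l(1) q k(1) r(1)])
        show "T (\<lambda>z. h z + k n z) a \<noteq> T h a" using that by (simp add: W_def)
      qed (use close ql k(2) in blast)+
      moreover have "T f' a = T (l n) a" if "a \<notin> W n" for a
      proof -
        have "\<not> dist (y n) a < \<rho> n / 2" using that \<rho>(2) [of n a] \<rho>(1) [of n] by fastforce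
        then show ?thesis using g'0 by (simp add: f' l)
      qed
      ultimately have "T q a = T (l n) a \<or> T f' a = T (l n) a" for a by blast
      then have "q w = l n w \<or> f' w = l n w" by (intro separates_back q f' l)
      then show False using w spike(2) [OF d] by (auto simp: q_def)
    qed
    then show ?thesis using fw by blast
  qed
  obtain d1 where d1: "d1 > 0" "\<And>a b. dist a b < d1 \<Longrightarrow> dist (f a) (f b) < 1 / 3"
    using f(1) unfolding unif_cont_funs_iff by (metis zero_less_divide_1_iff zero_less_numeral)
  obtain d2 where d2: "d2 > 0" "\<And>a b. dist a b < d2 \<Longrightarrow> dist (h a) (h b) < 1 / 3"
    using h(1) unfolding unif_cont_funs_iff by (metis zero_less_divide_1_iff zero_less_numeral)
  have "eventually (\<lambda>n. dist (x n) (z n) < min (d1 / 2) d2) sequentially"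
    using d1 d2 by (intro order_tendstoD [OF z(3)]) auto
  then obtain n where n: "dist (x n) (z n) < d1 / 2" "dist (x n) (z n) < d2"
    by (auto simp: eventually_sequentially)
  obtain w where w: "dist (x n) w \<le> r n" "f w = l n w" using fx by blast
  have "dist w (z n) < d1"
    using w(1) r(2) [of n] n(1) dist_triangle3 [of w "z n" "x n"] by linarith
  then have "dist (l n w) (h (z n)) < 1 / 3" using d1(2) w(2) fz by metis
  moreover have "dist (h (x n)) (h (z n)) < 1 / 3" using d2(2) n(2) by blast
  moreover have "dist (l n w) (l n (x n)) < 1 / 3" using r(4) [OF w(1)] by (simp add: dist_norm)
  ultimately have "dist (l n (x n)) (h (x n)) \<le> 1"
    using dist_triangle [of "l n (x n)" "h (x n)" "h (z n)"] dist_triangle3 [of "l n (x n)" "h (z n)" "l n w"]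
    by (simp add: dist_commute)
  then show ?thesis by (auto simp: dist_norm l_def h_def)
qed

context
  fixes x :: "nat \<Rightarrow> 'a" and \<delta> :: real
  assumes \<delta>: "\<delta> > 0" and sep: "\<And>i j. i \<noteq> j \<Longrightarrow> \<delta> \<le> dist (x i) (x j)"
    and near: "\<And>e. e > 0 \<Longrightarrow> eventually (\<lambda>n. \<exists>z. z \<noteq> x n \<and> dist (x n) z \<le> e) sequentially"
begin

text \<open>A failure would give parameters \<open>t m\<close> tending to \<open>s\<close> along a strictly increasing sequence of
  indices \<open>n m\<close>, contrary to \<open>levels_close_somewhere\<close> applied to the subsequence \<open>x (n m)\<close>.\<close>

lemma nearby_levels_close:
  "\<exists>c>0. \<exists>N. \<forall>t n. \<bar>t - s\<bar> < c \<longrightarrow> n \<ge> N \<longrightarrow> norm (level t (x n) - level s (x n)) \<le> 1"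
proof (rule ccontr)
  assume neg: "\<not> ?thesis"
  have ex: "\<exists>n t z. n \<ge> N \<and> \<bar>t - s\<bar> < c \<and> norm (level t (x n) - level s (x n)) > 1
      \<and> z \<noteq> x n \<and> dist (x n) z \<le> c \<and> dist (x n) z < \<delta> / 4" if "c > 0" for c N
  proof -
    \<comment> \<open>\<open>near\<close> gives a weak inequality; \<open>\<delta> / 5\<close> leaves room for the strict bound by \<open>\<delta> / 4\<close>.\<close>
    have pos: "min c (\<delta> / 5) > 0" using that \<delta> by simp
    obtain N' where N': "\<And>n. n \<ge> N' \<Longrightarrow> \<exists>z. z \<noteq> x n \<and> dist (x n) z \<le> min c (\<delta> / 5)"
      using near [OF pos] unfolding eventually_sequentially by blast
    have "\<not> (\<forall>t n. \<bar>t - s\<bar> < c \<longrightarrow> n \<ge> max N N' \<longrightarrow> norm (level t (x n) - level s (x n)) \<le> 1)"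
      using neg that by blast
    then obtain t n where tn: "\<bar>t - s\<bar> < c" "n \<ge> max N N'" "norm (level t (x n) - level s (x n)) > 1"
      unfolding not_all not_imp not_le by blast
    then obtain z where "z \<noteq> x n" "dist (x n) z \<le> min c (\<delta> / 5)" using N' [of n] by auto
    then show ?thesis using tn \<delta> by (intro exI [of _ n] exI [of _ t] exI [of _ z]) auto
  qed
  define Q where "Q m p \<longleftrightarrow> (case p of (n, t, z) \<Rightarrow> \<bar>t - s\<bar> < 1 / (real m + 1)
      \<and> norm (level t (x n) - level s (x n)) > 1
      \<and> z \<noteq> x n \<and> dist (x n) z \<le> 1 / (real m + 1) \<and> dist (x n) z < \<delta> / 4)" for m and p :: "nat \<times> real \<times> 'a"
  have "\<exists>p. \<forall>m. Q m (p m) \<and> fst (p m) < fst (p (Suc m))"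
  proof (rule dependent_nat_choice)
    show "\<exists>p. Q 0 p" using ex [of 1 0] by (auto simp: Q_def)
    show "\<exists>p'. Q (Suc m) p' \<and> fst p < fst p'" for p m
      using ex [of "1 / (real (Suc m) + 1)" "Suc (fst p)"] by (fastforce simp: Q_def)
  qed
  then obtain p where p: "\<And>m. Q m (p m)" "\<And>m. fst (p m) < fst (p (Suc m))" by blast
  define n where "n m = fst (p m)" for m
  define t where "t m = fst (snd (p m))" for m
  define z where "z m = snd (snd (p m))" for m
  have q: "\<bar>t m - s\<bar> < 1 / (real m + 1)" "norm (level (t m) (x (n m)) - level s (x (n m))) > 1"
    "z m \<noteq> x (n m)" "dist (x (n m)) (z m) \<le> 1 / (real m + 1)" "dist (x (n m)) (z m) < \<delta> / 4" for m
    using p(1) [of m] by (auto simp: Q_def n_def t_def z_def split: prod.splits)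
  have "strict_mono n" using p(2) by (simp add: strict_mono_Suc_iff n_def)
  then have inj: "n i \<noteq> n j" if "i \<noteq> j" for i j
    using that strict_mono_eq by blast
  have lim: "(\<lambda>n. 1 / (real n + 1)) \<longlonglongrightarrow> 0"
    using LIMSEQ_inverse_real_of_nat by (simp add: inverse_eq_divide add.commute)
  have "\<exists>m. norm (level (t m) (x (n m)) - level s (x (n m))) \<le> 1"
  proof (rule levels_close_somewhere [OF \<delta>, where z = z])
    show "\<delta> \<le> dist (x (n i)) (x (n j))" if "i \<noteq> j" for i j by (intro sep inj that)
    show "(\<lambda>m. dist (x (n m)) (z m)) \<longlonglongrightarrow> 0"
      by (rule tendsto_sandwich [OF _ _ tendsto_const lim]) (auto simp: q)
    have "(\<lambda>m. t m - s) \<longlonglongrightarrow> 0"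
      by (rule tendsto_rabs_zero_cancel, rule tendsto_sandwich [OF _ _ tendsto_const lim])
        (auto intro!: always_eventually less_imp_le q)
    then show "t \<longlonglongrightarrow> s" by (simp add: LIM_zero_iff)
  qed (use q in auto)
  then show False using q(2) by (meson not_le)
qed

text \<open>To stay at bounded distance along \<open>x\<close> is an equivalence relation between parameters with open
  classes, so the connected real line is a single class.\<close>

lemma levels_bounded_distance:
  "\<exists>K N. \<forall>n\<ge>N. norm (level s (x n) - level t (x n)) \<le> K"
proof -
  define R where "R s t \<longleftrightarrow> (\<exists>K N. \<forall>n\<ge>N. norm (level s (x n) - level t (x n)) \<le> K)" for s t
  have "R s t"
  proof (rule connected_equivalence_relation [of "UNIV :: real set"])
    show "R b a" if "R a b" for a b
      using that by (simp add: R_def norm_minus_commute)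
    show "R a c" if ab: "R a b" and bc: "R b c" for a b c
    proof -
      obtain K N where KN: "\<And>n. n \<ge> N \<Longrightarrow> norm (level a (x n) - level b (x n)) \<le> K"
        using ab R_def by blast
      obtain K' N' where KN': "\<And>n. n \<ge> N' \<Longrightarrow> norm (level b (x n) - level c (x n)) \<le> K'"
        using bc R_def by blast
      have "norm (level a (x n) - level c (x n)) \<le> K + K'" if "n \<ge> max N N'" for n
        using KN [of n] KN' [of n] that
          norm_triangle_ineq [of "level a (x n) - level b (x n)" "level b (x n) - level c (x n)"]
        by simp
      then show ?thesis unfolding R_def by blast
    qed
    show "\<exists>S. openin (top_of_set UNIV) S \<and> a \<in> S \<and> (\<forall>b\<in>S. R a b)" for a
    proof -
      obtain c N where c: "c > 0"
        "\<And>t n. \<bar>t - a\<bar> < c \<Longrightarrow> n \<ge> N \<Longrightarrow> norm (level t (x n) - level a (x n)) \<le> 1"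
        using nearby_levels_close by blast
      then have "R a b" if "b \<in> ball a c" for b
      proof -
        have "\<bar>b - a\<bar> < c" using that by (simp add: dist_real_def abs_minus_commute)
        then have "\<forall>n\<ge>N. norm (level a (x n) - level b (x n)) \<le> 1"
          using c(2) by (metis norm_minus_commute)
        then show ?thesis unfolding R_def by blast
      qed
      then show ?thesis using c(1) by (intro exI [of _ "ball a c"]) auto
    qed
  qed auto
  then show ?thesis by (simp add: R_def)
qed

end

text \<open>Values can be prescribed freely on different \<open>e\<close>-sets without affecting uniform
  continuity, in particular the values \<open>level n\<close> at points \<open>x n\<close> of distinct \<open>e\<close>-sets.\<close>

lemma finite_eps_sets_if_biseparating:
  assumes "e > 0"
  shows "finite (eps_sets (UNIV :: 'a set) e)"
proof (rule ccontr)
  assume inf: "infinite (eps_sets (UNIV :: 'a set) e)"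
  obtain C :: "nat \<Rightarrow> 'a set" where C: "inj C" "range C \<subseteq> eps_sets UNIV e"
    using infinite_countable_subset [OF inf] by blast
  have C': "C n \<in> UNIV // reachable e" for n using C(2) by (auto simp: eps_sets_eq)
  then have "\<exists>x. x \<in> C n" for n
    using in_quotient_imp_non_empty [OF equiv_reachable] by (metis ex_in_conv)
  then obtain x where x: "\<And>n. x n \<in> C n" by metis
  have same: "a \<in> C n \<longleftrightarrow> b \<in> C n" if "dist a b \<le> e" for a b n
    using in_quotient_imp_closed [OF equiv_reachable C'] reachable_if_close [OF that]
      reachable_if_close [of b a e] that by (metis dist_commute)
  have disj: "i = j" if "a \<in> C i" "a \<in> C j" for a i j
    using quotient_disj [OF equiv_reachable C' C'] that injD [OF C(1)] by blast
  define g where "g n z = (if z \<in> C n then level (real n) (x n) else 0)" for n z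
  have gdisj: "g i z = 0 \<or> g j z = 0" if "i \<noteq> j" for i j z
    using disj that by (auto simp: g_def)
  have "glue g \<in> unif_cont_funs"
  proof (rule glue_unif_cont [OF gdisj])
    fix \<epsilon> :: real assume "\<epsilon> > 0"
    moreover have "g n a = g n b" if "dist a b < e" for n a b
      using same [of a b n] that by (simp add: g_def)
    ultimately show "\<exists>d>0. \<forall>n a b. dist a b < d \<longrightarrow> dist (g n a) (g n b) < \<epsilon>"
      using assms by (intro exI [of _ e]) auto
  qed auto
  moreover have "glue g (x n) = level (real n) (x n)" for n
  proof (cases "g n (x n) = 0")
    case True
    then have "g m (x n) = 0" for m using disj [OF x, of n m] by (auto simp: g_def)
    then show ?thesis using True x by (simp add: glue_zero g_def)
  next
    case False
    then show ?thesis using glue_eq [of g "x n" n] gdisj x by (simp add: g_def)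
  qed
  moreover have "e \<le> dist (x i) (x j)" if "i \<noteq> j" for i j
    using same [of "x i" "x j" i] x disj [of "x j" i j] that by fastforce
  ultimately show False using no_interpolation [OF assms] by blast
qed

text \<open>An unbounded \<open>D\<close> would give room for tents over the real line of slope at most one, with
  vertex at \<open>t m\<close> and height \<open>w m = level m - level 0\<close> taken at a point where \<open>D = t m\<close>: the
  half-width \<open>K m\<close> bounds the norm of \<open>level m - level 0\<close> at all late points of the sequence \<open>x\<close>,
  and so can be fixed before \<open>t m\<close> is chosen far out.\<close>

lemma unif_cont_real_bounded_above_if_biseparating:
  fixes D :: "'a \<Rightarrow> real"
  assumes D: "D \<in> unif_cont_funs"
  shows "\<exists>M. \<forall>x. D x \<le> M"
proof (rule ccontr)
  assume "\<not> ?thesis"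
  then have unb: "\<exists>x. D x > M" for M by (meson not_le)
  have "\<exists>x. \<forall>n. True \<and> D (x (Suc n)) \<ge> D (x n) + 1"
    using unb by (intro dependent_nat_choice) (auto intro: less_imp_le)
  then obtain x where x: "\<And>n. D (x (Suc n)) \<ge> D (x n) + 1" by blast
  have grow: "D (x (m + n)) \<ge> D (x m) + real n" for m n
  proof (induction n)
    case (Suc n)
    then show ?case using x [of "m + n"] by simp
  qed simp
  have lt: "D (x j) \<ge> D (x i) + 1" if "i < j" for i j
    using grow [of i "j - i"] that by simp
  obtain \<delta> where \<delta>: "\<delta> > 0" "\<And>a b. dist a b < \<delta> \<Longrightarrow> dist (D a) (D b) < 1"
    using D unfolding unif_cont_funs_iff by (meson zero_less_one)
  have sep: "\<delta> \<le> dist (x i) (x j)" if "i \<noteq> j" for i j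
  proof (rule ccontr)
    assume "\<not> ?thesis"
    then have "dist (D (x i)) (D (x j)) < 1" using \<delta>(2) by auto
    moreover have "i < j \<or> j < i" using that by auto
    ultimately show False using lt [of i j] lt [of j i] by (auto simp: dist_real_def)
  qed
  have "inj x" using sep \<delta>(1) by (metis dist_self injI not_le)
  then have near: "eventually (\<lambda>n. \<exists>z. z \<noteq> x n \<and> dist (x n) z \<le> e) sequentially" if "e > 0" for e
    using eventually_not_isolated finite_eps_sets_if_biseparating [OF that] by blast
  have "\<exists>K N. \<forall>n\<ge>N. norm (level (real m) (x n) - level 0 (x n)) \<le> K" for m
    by (rule levels_bounded_distance [OF \<delta>(1) sep near])
  then obtain K' N where K': "\<And>m n. n \<ge> N m \<Longrightarrow> norm (level (real m) (x n) - level 0 (x n)) \<le> K' m"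
    by metis
  define K where "K m = max 1 (K' m)" for m
  have K1: "K m \<ge> 1" for m by (simp add: K_def)
  have K: "norm (level (real m) (x n) - level 0 (x n)) \<le> K m" if "n \<ge> N m" for m n
    using K' [OF that] by (simp add: K_def)
  \<comment> \<open>The last condition makes the supports of consecutive tents disjoint.\<close>
  have "\<exists>k. \<forall>m. k m \<ge> N m \<and> (k m < k (Suc m) \<and> D (x (k m)) + K m \<le> D (x (k (Suc m))) - K (Suc m))"
  proof (rule dependent_nat_choice)
    fix i m
    obtain n :: nat where "real n \<ge> D (x i) + K m + K (Suc m) - D (x 0)" using real_arch_simple by blast
    define j where "j = n + N (Suc m) + Suc i"
    have "D (x j) \<ge> D (x 0) + real j" "real j \<ge> real n"
      using grow [of 0 j] by (auto simp: j_def)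
    then have "D (x i) + K m \<le> D (x j) - K (Suc m)"
      using \<open>real n \<ge> _\<close> by simp
    moreover have "j \<ge> N (Suc m)" "i < j" by (auto simp: j_def)
    ultimately show "\<exists>j. j \<ge> N (Suc m) \<and> (i < j \<and> D (x i) + K m \<le> D (x j) - K (Suc m))" by blast
  qed auto
  then obtain k where k: "\<And>m. k m \<ge> N m" "\<And>m. k m < k (Suc m)"
    "\<And>m. D (x (k m)) + K m \<le> D (x (k (Suc m))) - K (Suc m)" by blast
  define t where "t m = D (x (k m))" for m
  define w where "w m = level (real m) (x (k m)) - level 0 (x (k m))" for m
  have w: "norm (w m) \<le> K m" for m unfolding w_def using K k(1) by blast
  have tsep: "t i + K i \<le> t j - K j" if "i < j" for i j
  proof -
    have "t m + K m \<le> t (Suc m) + K (Suc m)" for m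
      using k(3) [of m] K1 [of "Suc m"] by (simp add: t_def)
    then have "t i + K i \<le> t (j - 1) + K (j - 1)"
      using that lift_Suc_mono_le [of "\<lambda>m. t m + K m" i "j - 1"] by simp
    also have "\<dots> \<le> t j - K j" using k(3) [of "j - 1"] that by (simp add: t_def)
    finally show ?thesis .
  qed
  define g where "g m z = max 0 (1 - \<bar>D z - t m\<bar> / K m) *\<^sub>R w m" for m z
  have g0: "\<bar>D z - t m\<bar> < K m" if "g m z \<noteq> 0" for m z
    using that K1 [of m] by (auto simp: g_def max_def field_simps split: if_splits)
  have gdisj: "g i z = 0 \<or> g j z = 0" if "i \<noteq> j" for i j z
  proof (rule ccontr)
    assume "\<not> ?thesis"
    then have "\<bar>D z - t i\<bar> < K i" "\<bar>D z - t j\<bar> < K j" using g0 by auto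
    then show False using tsep [of i j] tsep [of j i] that by linarith
  qed
  have glip: "dist (g m a) (g m b) \<le> dist (D a) (D b)" for m a b
  proof -
    have tent: "\<bar>max 0 (1 - p) - max 0 (1 - q)\<bar> \<le> \<bar>p - q\<bar>" for p q :: real
      by linarith
    have "\<bar>max 0 (1 - \<bar>D a - t m\<bar> / K m) - max 0 (1 - \<bar>D b - t m\<bar> / K m)\<bar>
        \<le> \<bar>\<bar>D a - t m\<bar> / K m - \<bar>D b - t m\<bar> / K m\<bar>" by (rule tent)
    also have "\<dots> = \<bar>\<bar>D a - t m\<bar> - \<bar>D b - t m\<bar>\<bar> / K m"
      using K1 [of m] by (simp add: diff_divide_distrib [symmetric])
    also have "\<dots> \<le> \<bar>D a - D b\<bar> / K m"
      using K1 [of m] by (intro divide_right_mono) auto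
    finally have "\<bar>max 0 (1 - \<bar>D a - t m\<bar> / K m) - max 0 (1 - \<bar>D b - t m\<bar> / K m)\<bar> * norm (w m)
        \<le> \<bar>D a - D b\<bar> / K m * norm (w m)" by (rule mult_right_mono) simp
    then have "dist (g m a) (g m b) \<le> \<bar>D a - D b\<bar> / K m * norm (w m)"
      unfolding g_def dist_norm scaleR_diff_left [symmetric] norm_scaleR .
    also have "\<dots> \<le> \<bar>D a - D b\<bar> / K m * K m"
      using K1 [of m] w by (intro mult_left_mono) auto
    finally show ?thesis using K1 [of m] by (simp add: dist_real_def)
  qed
  have "glue g \<in> unif_cont_funs"
  proof (rule glue_unif_cont [OF gdisj])
    fix e :: real assume "e > 0"
    then show "\<exists>d>0. \<forall>n a b. dist a b < d \<longrightarrow> dist (g n a) (g n b) < e"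
      using D glip unfolding unif_cont_funs_iff by (meson le_less_trans)
  qed auto
  then have P: "(\<lambda>z. level 0 z + glue g z) \<in> unif_cont_funs"
    by (intro unif_cont_funs_add level)
  have gx: "glue g (x (k n)) = w n" for n
  proof (cases "w n = 0")
    case True
    have "g m (x (k n)) = 0" for m
    proof (cases "m = n")
      case False
      have "\<not> \<bar>D (x (k n)) - t m\<bar> < K m"
        using tsep [of m n] tsep [of n m] False K1 [of n] K1 [of m] unfolding t_def [of n, symmetric]
        by linarith
      then show ?thesis using g0 by blast
    qed (simp add: g_def True)
    then show ?thesis using True by (simp add: glue_zero)
  next
    case False
    have "g n (x (k n)) = w n" by (simp add: g_def t_def)
    then show ?thesis using False glue_eq [of g "x (k n)" n] gdisj by simp
  qed
  have "strict_mono k" using k(2) by (simp add: strict_mono_Suc_iff)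
  then have ksep: "\<delta> \<le> dist (x (k i)) (x (k j))" if "i \<noteq> j" for i j
    using that by (intro sep) (simp add: strict_mono_eq)
  have "level 0 (x (k n)) + glue g (x (k n)) = level (real n) (x (k n))" for n
    by (simp add: gx w_def)
  then show False
    using no_interpolation [where x = "\<lambda>n. x (k n)", OF \<delta>(1) _ P] ksep by blast
qed

end

theorem theorem7p11:
  fixes T :: "('a::complete_space \<Rightarrow> 'e::banach) \<Rightarrow> ('b::complete_space \<Rightarrow> 'f::banach)"
  assumes "\<exists>u::'e. u \<noteq> 0"
    and "\<exists>v::'f. v \<noteq> 0"
    and "biseparating unif_cont_funs bdd_unif_cont_funs T"
  shows "bourbaki_bounded (UNIV :: 'a set)"
proof (rule ccontr)
  obtain u :: 'e and v :: 'f where "u \<noteq> 0" "v \<noteq> 0" using assms(1,2) by blast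
  then interpret biseparating_unif T u v using assms(3) by unfold_locales
  assume "\<not> bourbaki_bounded (UNIV :: 'a set)"
  then show False
  proof (cases rule: not_bourbaki_bounded_cases)
    case (many e)
    then show False using finite_eps_sets_if_biseparating by blast
  next
    case (far D)
    then show False using unif_cont_real_bounded_above_if_biseparating by (meson not_le)
  qed
qed

end
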